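(* Let $i\in\{0,1\}$. The normal $\mathcal{L}$-logic $\mathbf{L}_i$ is sound and complete with respect to its corresponding class $\mathcal{K}_i$ of graph-based $\mathbf{A}$-frames, where $\mathcal{K}_0$ is the class of graph-based $\mathbf{A}$-frames on which $\Box\bot\vdash\bot$ is valid and $\mathcal{K}_1$ is the class of graph-based $\mathbf{A}$-frames on which $\Box p\vdash p$ is valid. That is, for all formulas $\phi,\psi\in\mathcal{L}$, the sequent $\phi\vdash\psi$ belongs to $\mathbf{L}_i$ if and only if $\phi\vdash\psi$ is valid on every $\mathbb{G}\in\mathcal{K}_i$.
   Context: **Truth values.** $\mathbf{A}=(D,1,0,\vee,\wedge,\otimes,\to)$ is a fixed complete lattice with top $1$ and bottom $0$, $0\neq 1$, that is frame-distributive ($a\wedge\bigvee_i b_i=\bigvee_i(a\wedge b_i)$) and dually frame-distributive ($a\vee\bigwedge_i b_i=\bigwedge_i(a\vee b_i)$), with a commutative associative operation $\otimes$ residuated by $\to$ ($\alpha\otimes\beta\le\gamma$ iff $\alpha\le\beta\to\gamma$), and such that $1\to\alpha=\alpha$ for all $\alpha$. For a set $W$, $\mathbf{A}^W$ is the set of maps $W\to\mathbf{A}$, ordered pointwise; $u\subseteq v$ means $u\le v$ pointwise. For $\alpha\in\mathbf{A}$, $w\in W$, the map $\{\alpha/w\}:W\to\mathbf{A}$ sends $w$ to $\alpha$ and every other element to $0$. An $\mathbf{A}$-relation $E:Z\times Z\to\mathbf{A}$ is reflexive if $E(z,z)=1$ for all $z$. **Language and logics.** Let $\mathsf{Prop}$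 be a countable or finite set of atomic propositions. Formulas of $\mathcal{L}$: $\varphi::=\bot\mid\top\mid p\mid\varphi\wedge\varphi\mid\varphi\vee\varphi\mid\Box\varphi\mid\Diamond\varphi$, with $p\in\mathsf{Prop}$. A sequent is an expression $\phi\vdash\psi$ with $\phi,\psi\in\mathcal{L}$. The basic logic $\mathbf{L}$ is the least set of sequents containing the axioms $p\vdash p$, $\bot\vdash p$, $p\vdash\top$, $p\vdash p\vee q$, $q\vdash p\vee q$, $p\wedge q\vdash p$, $p\wedge q\vdash q$, $\top\vdash\Box\top$, $\Box p\wedge\Box q\vdash\Box(p\wedge q)$, $\Diamond\bot\vdash\bot$, $\Diamond(p\vee q)\vdash\Diamond p\vee\Diamond q$, and closed under: from $\phi\vdash\chi$ and $\chi\vdash\psi$ infer $\phi\vdash\psi$; uniform substitution of formulas for atomic propositions; from $\chi\vdash\phi$ and $\chi\vdash\psi$ infer $\chi\vdash\phi\wedge\psi$; from $\phi\vdash\chi$ and $\psi\vdash\chi$ infer $\phi\vee\psi\vdash\chi$; from $\phi\vdash\psi$ infer $\Box\phi\vdash\Box\psi$; from $\phi\vdash\psi$ infer $\Diamond\phi\vdash\Diamond\psi$. $\mathbf{L}_0$ (resp. $\mathbf{L}_1$) is the least such set additionally containing $\Box\bot\vdash\bot$ (resp. $\Box p\vdash p$). **Frames (convention used for this result).** Let $Z$ be a nonempty set, $E:Z\times Z\to\mathbf{A}$ reflexive, and $R_\Diamond,R_\Box:Z\times Z\to\mathbf{A}$. Put $Z_A:=Z$ and $Z_X:=\mathbf{A}\times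 Z$. For $f:Z_A\to\mathbf{A}$ and $u:Z_X\to\mathbf{A}$ define - $f^{[1]}(\alpha,z)=\bigwedge_{z'\in Z}[f(z')\to(E(z',z)\to\alpha)]$, - $u^{[0]}(z)=\bigwedge_{(\alpha,z')\in Z_X}[u(\alpha,z')\to(E(z,z')\to\alpha)]$, - $R_\Box^{[0]}[u](z)=\bigwedge_{(\alpha,z')\in Z_X}[u(\alpha,z')\to(R_\Box(z,z')\to\alpha)]$, - $R_\Box^{[1]}[f](\alpha,z)=\bigwedge_{z'\in Z}[f(z')\to(R_\Box(z',z)\to\alpha)]$, - $R_\Diamond^{[0]}[f](\alpha,z)=\bigwedge_{z'\in Z}[f(z')\to(R_\Diamond(z,z')\to\alpha)]$, - $R_\Diamond^{[1]}[u](z)=\bigwedge_{(\alpha,z')\in Z_X}[u(\alpha,z')\to(R_\Diamond(z',z)\to\alpha)]$, and write $f^{[10]}=(f^{[1]})^{[0]}$, $u^{[01]}=(u^{[0]})^{[1]}$. The structure $\mathbb{G}=(Z,E,R_\Diamond,R_\Box)$ is a *graph-based $\mathbf{A}$-frame* if for all $z\in Z$, $\alpha,\beta\in\mathbf{A}$: $(R_\Box^{[0]}[\{\beta/(\alpha,z)\}])^{[10]}\subseteq R_\Box^{[0]}[\{\beta/(\alpha,z)\}]$, $(R_\Box^{[1]}[\{\beta/z\}])^{[01]}\subseteq R_\Box^{[1]}[\{\beta/z\}]$, $(R_\Diamond^{[1]}[\{\beta/(\alpha,z)\}])^{[10]}\subseteq R_\Diamond^{[1]}[\{\beta/(\alpha,z)\}]$,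 $(R_\Diamond^{[0]}[\{\beta/z\}])^{[01]}\subseteq R_\Diamond^{[0]}[\{\beta/z\}]$. **Models and validity.** A model on $\mathbb{G}$ is given by a valuation $V$ assigning to each $p\in\mathsf{Prop}$ a pair $V(p)=([\![p]\!],(\![p]\!))$ with $[\![p]\!]:Z_A\to\mathbf{A}$, $(\![p]\!):Z_X\to\mathbf{A}$, $[\![p]\!]^{[1]}=(\![p]\!)$ and $(\![p]\!)^{[0]}=[\![p]\!]$, extended to all formulas by - $[\![\top]\!]=1$ (constant), $(\![\top]\!)=[\![\top]\!]^{[1]}$; $(\![\bot]\!)=1$ (constant), $[\![\bot]\!]=(\![\bot]\!)^{[0]}$; - $[\![\phi\wedge\psi]\!]=[\![\phi]\!]\wedge[\![\psi]\!]$, $(\![\phi\wedge\psi]\!)=[\![\phi\wedge\psi]\!]^{[1]}$; $(\![\phi\vee\psi]\!)=(\![\phi]\!)\wedge(\![\psi]\!)$, $[\![\phi\vee\psi]\!]=(\![\phi\vee\psi]\!)^{[0]}$; - $[\![\Box\phi]\!]=R_\Box^{[0]}[(\![\phi]\!)]$, $(\![\Box\phi]\!)=[\![\Box\phi]\!]^{[1]}$; $(\![\Diamond\phi]\!)=R_\Diamond^{[0]}[[\![\phi]\!]]$, $[\![\Diamond\phi]\!]=(\![\Diamond\phi]\!)^{[0]}$. A sequent $\phi\vdash\psi$ is true in a model if $[\![\phi]\!]\subseteq[\![\psi]\!]$, and valid on $\mathbb{G}$ if it is true in every model on $\mathbb{G}$. *)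

theory Defs
  imports "HOL-Library.Countable"
begin

section \<open>Truth values\<close>

text \<open>
  The library class \<open>complete_distrib_lattice\<close> demands complete distributivity, which is
  strictly stronger than the two frame laws below; hence the axioms are listed explicitly.
\<close>

class truth_values = complete_lattice +
  fixes tensor :: "'a \<Rightarrow> 'a \<Rightarrow> 'a" (infixl \<open>\<otimes>\<close> 70)
    and residual :: "'a \<Rightarrow> 'a \<Rightarrow> 'a" (infixr \<open>\<rightarrow>\<close> 60)
  assumes bot_neq_top: "bot \<noteq> top"
    and inf_frame: "inf a (Sup B) = (SUP b\<in>B. inf a b)"
    and sup_coframe: "sup a (Inf B) = (INF b\<in>B. sup a b)"
    and tensor_commute: "a \<otimes> b = b \<otimes> a"
    and tensor_assoc: "(a \<otimes> b) \<otimes> c = a \<otimes> (b \<otimes> c)"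
    and residuation: "a \<otimes> b \<le> c \<longleftrightarrow> a \<le> (b \<rightarrow> c)"
    and top_residual: "(top \<rightarrow> a) = a"


section \<open>Formulas and logics\<close>

datatype 'p fm =
    FBot | FTop | Atom 'p
  | And "'p fm" "'p fm" | Or "'p fm" "'p fm"
  | Box "'p fm" | Dia "'p fm"

type_synonym 'p sequent = "'p fm \<times> 'p fm"

primrec fm_subst :: "('p \<Rightarrow> 'p fm) \<Rightarrow> 'p fm \<Rightarrow> 'p fm" where
  "fm_subst \<sigma> FBot = FBot"
| "fm_subst \<sigma> FTop = FTop"
| "fm_subst \<sigma> (Atom p) = \<sigma> p"
| "fm_subst \<sigma> (And \<phi> \<psi>) = And (fm_subst \<sigma> \<phi>) (fm_subst \<sigma> \<psi>)"
| "fm_subst \<sigma> (Or \<phi> \<psi>) = Or (fm_subst \<sigma> \<phi>) (fm_subst \<sigma> \<psi>)"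
| "fm_subst \<sigma> (Box \<phi>) = Box (fm_subst \<sigma> \<phi>)"
| "fm_subst \<sigma> (Dia \<phi>) = Dia (fm_subst \<sigma> \<phi>)"

text \<open>
  \<open>logic \<Gamma>\<close> is the least normal logic containing the sequents \<open>\<Gamma>\<close>. The letters of the axioms
  range over formulas, so that the definition is also meaningful when there is just one atomic
  proposition (the axioms use two letters). Given two distinct atoms, this is the same as
  stating the axioms for these two atoms only: see \<open>lettered_logic_eq_logic\<close>.
\<close>

inductive_set logic :: "'p sequent set \<Rightarrow> 'p sequent set" for \<Gamma> :: "'p sequent set" where
  extra: "s \<in> \<Gamma> \<Longrightarrow> s \<in> logic \<Gamma>"
| ax_id: "(p, p) \<in> logic \<Gamma>"
| ax_bot: "(FBot, p) \<in> logic \<Gamma>"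
| ax_top: "(p, FTop) \<in> logic \<Gamma>"
| ax_or1: "(p, Or p q) \<in> logic \<Gamma>"
| ax_or2: "(q, Or p q) \<in> logic \<Gamma>"
| ax_and1: "(And p q, p) \<in> logic \<Gamma>"
| ax_and2: "(And p q, q) \<in> logic \<Gamma>"
| ax_box_top: "(FTop, Box FTop) \<in> logic \<Gamma>"
| ax_box_and: "(And (Box p) (Box q), Box (And p q)) \<in> logic \<Gamma>"
| ax_dia_bot: "(Dia FBot, FBot) \<in> logic \<Gamma>"
| ax_dia_or: "(Dia (Or p q), Or (Dia p) (Dia q)) \<in> logic \<Gamma>"
| cut: "(\<phi>, \<chi>) \<in> logic \<Gamma> \<Longrightarrow> (\<chi>, \<psi>) \<in> logic \<Gamma> \<Longrightarrow> (\<phi>, \<psi>) \<in> logic \<Gamma>"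
| subst: "(\<phi>, \<psi>) \<in> logic \<Gamma> \<Longrightarrow> (fm_subst \<sigma> \<phi>, fm_subst \<sigma> \<psi>) \<in> logic \<Gamma>"
| and_intro: "(\<chi>, \<phi>) \<in> logic \<Gamma> \<Longrightarrow> (\<chi>, \<psi>) \<in> logic \<Gamma> \<Longrightarrow> (\<chi>, And \<phi> \<psi>) \<in> logic \<Gamma>"
| or_elim: "(\<phi>, \<chi>) \<in> logic \<Gamma> \<Longrightarrow> (\<psi>, \<chi>) \<in> logic \<Gamma> \<Longrightarrow> (Or \<phi> \<psi>, \<chi>) \<in> logic \<Gamma>"
| box_mono: "(\<phi>, \<psi>) \<in> logic \<Gamma> \<Longrightarrow> (Box \<phi>, Box \<psi>) \<in> logic \<Gamma>"
| dia_mono: "(\<phi>, \<psi>) \<in> logic \<Gamma> \<Longrightarrow> (Dia \<phi>, Dia \<psi>) \<in> logic \<Gamma>"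

inductive_set lettered_logic :: "'p \<Rightarrow> 'p \<Rightarrow> 'p sequent set \<Rightarrow> 'p sequent set"
  for p q :: 'p and \<Gamma> :: "'p sequent set" where
  "s \<in> \<Gamma> \<Longrightarrow> s \<in> lettered_logic p q \<Gamma>"
| "(Atom p, Atom p) \<in> lettered_logic p q \<Gamma>"
| "(FBot, Atom p) \<in> lettered_logic p q \<Gamma>"
| "(Atom p, FTop) \<in> lettered_logic p q \<Gamma>"
| "(Atom p, Or (Atom p) (Atom q)) \<in> lettered_logic p q \<Gamma>"
| "(Atom q, Or (Atom p) (Atom q)) \<in> lettered_logic p q \<Gamma>"
| "(And (Atom p) (Atom q), Atom p) \<in> lettered_logic p q \<Gamma>"
| "(And (Atom p) (Atom q), Atom q) \<in> lettered_logic p q \<Gamma>"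
| "(FTop, Box FTop) \<in> lettered_logic p q \<Gamma>"
| "(And (Box (Atom p)) (Box (Atom q)), Box (And (Atom p) (Atom q))) \<in> lettered_logic p q \<Gamma>"
| "(Dia FBot, FBot) \<in> lettered_logic p q \<Gamma>"
| "(Dia (Or (Atom p) (Atom q)), Or (Dia (Atom p)) (Dia (Atom q))) \<in> lettered_logic p q \<Gamma>"
| "(\<phi>, \<chi>) \<in> lettered_logic p q \<Gamma> \<Longrightarrow> (\<chi>, \<psi>) \<in> lettered_logic p q \<Gamma>
    \<Longrightarrow> (\<phi>, \<psi>) \<in> lettered_logic p q \<Gamma>"
| "(\<phi>, \<psi>) \<in> lettered_logic p q \<Gamma>
    \<Longrightarrow> (fm_subst \<sigma> \<phi>, fm_subst \<sigma> \<psi>) \<in> lettered_logic p q \<Gamma>"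
| "(\<chi>, \<phi>) \<in> lettered_logic p q \<Gamma> \<Longrightarrow> (\<chi>, \<psi>) \<in> lettered_logic p q \<Gamma>
    \<Longrightarrow> (\<chi>, And \<phi> \<psi>) \<in> lettered_logic p q \<Gamma>"
| "(\<phi>, \<chi>) \<in> lettered_logic p q \<Gamma> \<Longrightarrow> (\<psi>, \<chi>) \<in> lettered_logic p q \<Gamma>
    \<Longrightarrow> (Or \<phi> \<psi>, \<chi>) \<in> lettered_logic p q \<Gamma>"
| "(\<phi>, \<psi>) \<in> lettered_logic p q \<Gamma> \<Longrightarrow> (Box \<phi>, Box \<psi>) \<in> lettered_logic p q \<Gamma>"
| "(\<phi>, \<psi>) \<in> lettered_logic p q \<Gamma> \<Longrightarrow> (Dia \<phi>, Dia \<psi>) \<in> lettered_logic p q \<Gamma>"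

lemma lettered_logic_eq_logic:
  assumes "p \<noteq> q"
  shows "lettered_logic p q \<Gamma> = logic \<Gamma>"
proof (intro set_eqI iffI)
  fix s assume "s \<in> lettered_logic p q \<Gamma>"
  then show "s \<in> logic \<Gamma>"
    by induction (blast intro: logic.intros)+
next
  fix s assume "s \<in> logic \<Gamma>"
  then show "s \<in> lettered_logic p q \<Gamma>"
  proof induction
    case (ax_id a)
    show ?case
      using lettered_logic.intros(14)[OF lettered_logic.intros(2)[of p q \<Gamma>], of "Atom(p := a)"] by simp
  next
    case (ax_bot a)
    show ?case
      using lettered_logic.intros(14)[OF lettered_logic.intros(3)[of p q \<Gamma>], of "Atom(p := a)"] by simp
  next
    case (ax_top a)
    show ?case
      using lettered_logic.intros(14)[OF lettered_logic.intros(4)[of p q \<Gamma>], of "Atom(p := a)"] by simp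
  next
    case (ax_or1 a b)
    show ?case
      using lettered_logic.intros(14)[OF lettered_logic.intros(5)[of p q \<Gamma>], of "Atom(p := a, q := b)"]
        assms by simp
  next
    case (ax_or2 b a)
    show ?case
      using lettered_logic.intros(14)[OF lettered_logic.intros(6)[of q p \<Gamma>], of "Atom(p := a, q := b)"]
        assms by simp
  next
    case (ax_and1 a b)
    show ?case
      using lettered_logic.intros(14)[OF lettered_logic.intros(7)[of p q \<Gamma>], of "Atom(p := a, q := b)"]
        assms by simp
  next
    case (ax_and2 a b)
    show ?case
      using lettered_logic.intros(14)[OF lettered_logic.intros(8)[of p q \<Gamma>], of "Atom(p := a, q := b)"]
        assms by simp
  next
    case (ax_box_and a b)
    show ?case
      using lettered_logic.intros(14)[OF lettered_logic.intros(10)[of p q \<Gamma>], of "Atom(p := a, q := b)"]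
        assms by simp
  next
    case (ax_dia_or a b)
    show ?case
      using lettered_logic.intros(14)[OF lettered_logic.intros(12)[of p q \<Gamma>], of "Atom(p := a, q := b)"]
        assms by simp
  qed (blast intro: lettered_logic.intros)+
qed

text \<open>\<open>extra_axioms i\<close> is intended for \<open>i = 0\<close> and \<open>i = 1\<close> only.\<close>

definition extra_axioms :: "nat \<Rightarrow> 'p sequent set" where
  "extra_axioms i =
     (if i = 0 then {(Box FBot, FBot)} else range (\<lambda>p. (Box (Atom p), Atom p)))"


section \<open>Graph-based frames\<close>

text \<open>
  The carrier is a set \<open>Z\<close> inside the type of points. \<open>'a\<close>-valued sets over \<open>Z\<close> and over
  \<open>UNIV \<times> Z\<close> are represented by total functions of which only the values on the
  respective set matter.
\<close>

record ('z, 'a) gframe =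
  points :: "'z set"
  edge :: "'z \<Rightarrow> 'z \<Rightarrow> 'a"
  dia_rel :: "'z \<Rightarrow> 'z \<Rightarrow> 'a"
  box_rel :: "'z \<Rightarrow> 'z \<Rightarrow> 'a"

definition xpoints :: "('z, 'a) gframe \<Rightarrow> ('a \<times> 'z) set" where
  "xpoints G = UNIV \<times> points G"

definition subset_on :: "'w set \<Rightarrow> ('w \<Rightarrow> 'a::truth_values) \<Rightarrow> ('w \<Rightarrow> 'a) \<Rightarrow> bool" where
  "subset_on W u v \<longleftrightarrow> (\<forall>w\<in>W. u w \<le> v w)"

definition single :: "'a::truth_values \<Rightarrow> 'w \<Rightarrow> 'w \<Rightarrow> 'a" where
  "single \<alpha> w = (\<lambda>w'. if w' = w then \<alpha> else bot)"

definition up :: "('z, 'a::truth_values) gframe \<Rightarrow> ('z \<Rightarrow> 'a) \<Rightarrow> 'a \<times> 'z \<Rightarrow> 'a" where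
  "up G f = (\<lambda>(\<alpha>, z). INF z'\<in>points G. f z' \<rightarrow> (edge G z' z \<rightarrow> \<alpha>))"

definition down :: "('z, 'a::truth_values) gframe \<Rightarrow> ('a \<times> 'z \<Rightarrow> 'a) \<Rightarrow> 'z \<Rightarrow> 'a" where
  "down G u = (\<lambda>z. INF (\<alpha>, z')\<in>xpoints G. u (\<alpha>, z') \<rightarrow> (edge G z z' \<rightarrow> \<alpha>))"

definition box0 :: "('z, 'a::truth_values) gframe \<Rightarrow> ('a \<times> 'z \<Rightarrow> 'a) \<Rightarrow> 'z \<Rightarrow> 'a" where
  "box0 G u = (\<lambda>z. INF (\<alpha>, z')\<in>xpoints G. u (\<alpha>, z') \<rightarrow> (box_rel G z z' \<rightarrow> \<alpha>))"

definition box1 :: "('z, 'a::truth_values) gframe \<Rightarrow> ('z \<Rightarrow> 'a) \<Rightarrow> 'a \<times> 'z \<Rightarrow> 'a" where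
  "box1 G f = (\<lambda>(\<alpha>, z). INF z'\<in>points G. f z' \<rightarrow> (box_rel G z' z \<rightarrow> \<alpha>))"

definition dia0 :: "('z, 'a::truth_values) gframe \<Rightarrow> ('z \<Rightarrow> 'a) \<Rightarrow> 'a \<times> 'z \<Rightarrow> 'a" where
  "dia0 G f = (\<lambda>(\<alpha>, z). INF z'\<in>points G. f z' \<rightarrow> (dia_rel G z z' \<rightarrow> \<alpha>))"

definition dia1 :: "('z, 'a::truth_values) gframe \<Rightarrow> ('a \<times> 'z \<Rightarrow> 'a) \<Rightarrow> 'z \<Rightarrow> 'a" where
  "dia1 G u = (\<lambda>z. INF (\<alpha>, z')\<in>xpoints G. u (\<alpha>, z') \<rightarrow> (dia_rel G z' z \<rightarrow> \<alpha>))"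

definition graph_frame :: "('z, 'a::truth_values) gframe \<Rightarrow> bool" where
  "graph_frame G \<longleftrightarrow>
     points G \<noteq> {} \<and>
     (\<forall>z\<in>points G. edge G z z = top) \<and>
     (\<forall>z\<in>points G. \<forall>\<alpha> \<beta>.
        subset_on (points G)
          (down G (up G (box0 G (single \<beta> (\<alpha>, z))))) (box0 G (single \<beta> (\<alpha>, z))) \<and>
        subset_on (xpoints G)
          (up G (down G (box1 G (single \<beta> z)))) (box1 G (single \<beta> z)) \<and>
        subset_on (points G)
          (down G (up G (dia1 G (single \<beta> (\<alpha>, z))))) (dia1 G (single \<beta> (\<alpha>, z))) \<and>
        subset_on (xpoints G)
          (up G (down G (dia0 G (single \<beta> z)))) (dia0 G (single \<beta> z)))"


section \<open>Models and validity\<close>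

definition valuation ::
  "('z, 'a::truth_values) gframe \<Rightarrow> ('p \<Rightarrow> ('z \<Rightarrow> 'a) \<times> ('a \<times> 'z \<Rightarrow> 'a)) \<Rightarrow> bool" where
  "valuation G V \<longleftrightarrow>
     (\<forall>p. (\<forall>x\<in>xpoints G. up G (fst (V p)) x = snd (V p) x) \<and>
          (\<forall>z\<in>points G. down G (snd (V p)) z = fst (V p) z))"

text \<open>The two components of \<open>interp G V \<phi>\<close> are the extension and the intension of \<open>\<phi>\<close>.\<close>

primrec interp ::
  "('z, 'a::truth_values) gframe \<Rightarrow> ('p \<Rightarrow> ('z \<Rightarrow> 'a) \<times> ('a \<times> 'z \<Rightarrow> 'a)) \<Rightarrow> 'p fm
    \<Rightarrow> ('z \<Rightarrow> 'a) \<times> ('a \<times> 'z \<Rightarrow> 'a)" where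
  "interp G V FBot = (let u = (\<lambda>_. top) in (down G u, u))"
| "interp G V FTop = (let f = (\<lambda>_. top) in (f, up G f))"
| "interp G V (Atom p) = V p"
| "interp G V (And \<phi> \<psi>) =
     (let f = (\<lambda>z. inf (fst (interp G V \<phi>) z) (fst (interp G V \<psi>) z)) in (f, up G f))"
| "interp G V (Or \<phi> \<psi>) =
     (let u = (\<lambda>x. inf (snd (interp G V \<phi>) x) (snd (interp G V \<psi>) x)) in (down G u, u))"
| "interp G V (Box \<phi>) = (let f = box0 G (snd (interp G V \<phi>)) in (f, up G f))"
| "interp G V (Dia \<phi>) = (let u = dia0 G (fst (interp G V \<phi>)) in (down G u, u))"

definition true_in ::
  "('z, 'a::truth_values) gframe \<Rightarrow> ('p \<Rightarrow> ('z \<Rightarrow> 'a) \<times> ('a \<times> 'z \<Rightarrow> 'a)) \<Rightarrow> 'p sequent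
    \<Rightarrow> bool" where
  "true_in G V s \<longleftrightarrow>
     subset_on (points G) (fst (interp G V (fst s))) (fst (interp G V (snd s)))"

definition valid :: "('z, 'a::truth_values) gframe \<Rightarrow> 'p sequent \<Rightarrow> bool" where
  "valid G s \<longleftrightarrow> (\<forall>V. valuation G V \<longrightarrow> true_in G V s)"

definition frame_class :: "'p sequent set \<Rightarrow> ('z, 'a::truth_values) gframe set" where
  "frame_class \<Gamma> = {G. graph_frame G \<and> (\<forall>s\<in>\<Gamma>. valid G s)}"

text \<open>
  A formula of HOL cannot quantify over the frames on all sets. This type of points provides
  one for each pair of \<open>'a\<close>-valued sets of formulas, which leaves room for canonical models.
\<close>

type_synonym ('p, 'a) canonical_points = "('p fm \<Rightarrow> 'a) \<times> ('p fm \<Rightarrow> 'a)"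

end

theory Submission
  imports Defs
begin

text \<open>
  Soundness: every operation on a frame is one half of a Galois connection, and the frame
  conditions on singletons extend to all \<open>\<A>\<close>-valued sets, because these are joins of
  singletons. Hence \<open>box0\<close> and \<open>dia0\<close> only depend on the closure of their argument, which makes
  them normal.

  Completeness: since \<open>{0, 1}\<close> is a subalgebra of the truth values, a two-valued canonical frame
  suffices. Its points are pairs of a filter \<open>F\<close> and the complement \<open>J\<close> of an ideal with
  \<open>F \<subseteq> J\<close>, and \<open>E z z'\<close> holds iff \<open>F z \<subseteq> J z'\<close>. The frame conditions hold because each row
  and column of the modal relations is a row or column of \<open>E\<close>, or constantly \<open>0\<close>. That the
  required points exist depends on two facts: from \<open>\<top> \<turnstile> \<box>\<phi>\<close> follows \<open>\<top> \<turnstile> \<phi>\<close>, and from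
  \<open>\<diamond>\<phi> \<turnstile> \<bottom>\<close> follows \<open>\<phi> \<turnstile> \<bottom>\<close>. Both are read off Boolean evaluations with \<open>\<box>\<close> as identity.
  Two-valuedness matters: with many-valued filters and ideals \<open>J z\<close> could take a value strictly
  between \<open>0\<close> and \<open>1\<close> at \<open>\<diamond>\<top>\<close>, and then a row of \<open>R\<^sub>\<diamond>\<close> need not come from \<open>E\<close>.
\<close>

section \<open>Residuation\<close>

lemma residual_swap: "a \<le> (b \<rightarrow> c) \<longleftrightarrow> b \<le> (a \<rightarrow> (c :: 'a::truth_values))"
  by (metis residuation tensor_commute)

lemma bot_residual [simp]: "(bot \<rightarrow> a) = (top :: 'a::truth_values)"
  using residual_swap[of top bot a] by (simp add: top_unique)

lemma residual_top [simp]: "(a \<rightarrow> top) = (top :: 'a::truth_values)"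
  using residuation[of top a top] by (simp add: top_unique)

lemma residual_self [simp]: "(a \<rightarrow> a) = (top :: 'a::truth_values)"
  using residual_swap[of top a a] by (simp add: top_unique top_residual)

lemma residual_antimono: "a \<le> b \<Longrightarrow> (b \<rightarrow> c) \<le> (a \<rightarrow> (c :: 'a::truth_values))"
  by (meson residual_swap order_refl order_trans)

lemma residual_mono: "b \<le> c \<Longrightarrow> (a \<rightarrow> b) \<le> (a \<rightarrow> (c :: 'a::truth_values))"
  by (meson residuation order_refl order_trans)

lemma sup_residual: "(sup a b \<rightarrow> c) = inf (a \<rightarrow> c) (b \<rightarrow> (c :: 'a::truth_values))"
proof (rule antisym)
  show "(sup a b \<rightarrow> c) \<le> inf (a \<rightarrow> c) (b \<rightarrow> c)"
    by (simp add: residual_antimono)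
  show "inf (a \<rightarrow> c) (b \<rightarrow> c) \<le> (sup a b \<rightarrow> c)"
    by (metis residual_swap inf_le1 inf_le2 le_sup_iff)
qed


section \<open>Polarities\<close>

lemma subset_onI: "(\<And>w. w \<in> W \<Longrightarrow> u w \<le> v w) \<Longrightarrow> subset_on W u v"
  by (simp add: subset_on_def)

lemma subset_onD: "subset_on W u v \<Longrightarrow> w \<in> W \<Longrightarrow> u w \<le> v w"
  by (simp add: subset_on_def)

lemma subset_on_refl [simp]: "subset_on W u u"
  by (simp add: subset_on_def)

lemma subset_on_trans: "subset_on W u v \<Longrightarrow> subset_on W v w \<Longrightarrow> subset_on W u w"
  unfolding subset_on_def by (meson order_trans)

lemma subset_on_inf:
  "subset_on W u v \<Longrightarrow> subset_on W u v' \<Longrightarrow> subset_on W u (\<lambda>x. inf (v x) (v' x))"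
  by (simp add: subset_on_def)

lemma subset_on_inf_mono:
  "subset_on W u v \<Longrightarrow> subset_on W u' v' \<Longrightarrow> subset_on W (\<lambda>x. inf (u x) (u' x)) (\<lambda>x. inf (v x) (v' x))"
  unfolding subset_on_def by (meson inf_mono)

text \<open>One antitone map for an arbitrary kernel \<open>K\<close>; the six frame operations are
  the instances whose kernels have the form \<open>r \<rightarrow> \<alpha>\<close>.\<close>

definition polar ::
  "'s set \<Rightarrow> ('s \<Rightarrow> 'x \<Rightarrow> 'a::truth_values) \<Rightarrow> ('s \<Rightarrow> 'a) \<Rightarrow> 'x \<Rightarrow> 'a" where
  "polar S K f = (\<lambda>x. INF s\<in>S. f s \<rightarrow> K s x)"

text \<open>By \<open>residual_swap\<close>, both sides unfold to
  \<open>f s \<otimes> u x \<le> K s x\<close> for all \<open>s\<close> in \<open>S\<close> and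
  \<open>x\<close> in \<open>X\<close>.\<close>

lemma polar_adjoint:
  "subset_on X u (polar S K f) \<longleftrightarrow> subset_on S f (polar X (\<lambda>x s. K s x) u)"
  unfolding subset_on_def polar_def le_INF_iff using residual_swap by blast

lemma polar_antimono: "subset_on S f g \<Longrightarrow> subset_on X (polar S K g) (polar S K f)"
  unfolding subset_on_def polar_def by (meson INF_mono residual_antimono)

lemma polar_cong: "(\<And>s. s \<in> S \<Longrightarrow> f s = g s) \<Longrightarrow> polar S K f = polar S K g"
  by (auto simp: polar_def fun_eq_iff intro!: INF_cong)

lemma polar_sup: "polar S K (\<lambda>s. sup (f s) (g s)) = (\<lambda>x. inf (polar S K f x) (polar S K g x))"
  by (simp add: polar_def fun_eq_iff sup_residual INF_inf_distrib)

lemma polar_bot: "polar S K (\<lambda>_. bot) = (\<lambda>_. top)"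
  by (simp add: polar_def fun_eq_iff)

lemma polar_single:
  assumes "s \<in> S"
  shows "polar S K (single \<beta> s) x = (\<beta> \<rightarrow> K s x)"
proof (rule antisym)
  show "polar S K (single \<beta> s) x \<le> (\<beta> \<rightarrow> K s x)"
    unfolding polar_def using assms by (auto intro!: INF_lower2[of s] simp: single_def)
qed (auto simp: polar_def single_def intro!: INF_greatest)

text \<open>\<open>polar S K f\<close> is the pointwise meet of the polars of the singletons
  \<open>single (f s) s\<close>. Monotonicity puts its image under \<open>C\<close> below the image
  of each of these, hence below each of these.\<close>

lemma polar_closed:
  assumes mono: "\<And>f g. subset_on P f g \<Longrightarrow> subset_on P (C f) (C g)"
    and single: "\<And>s \<beta>. s \<in> S \<Longrightarrow> subset_on P (C (polar S K (single \<beta> s))) (polar S K (single \<beta> s))"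
  shows "subset_on P (C (polar S K f)) (polar S K f)"
proof (rule subset_onI)
  fix x assume x: "x \<in> P"
  have "C (polar S K f) x \<le> (f s \<rightarrow> K s x)" if s: "s \<in> S" for s
  proof -
    have "subset_on P (polar S K f) (polar S K (single (f s) s))"
      unfolding subset_on_def polar_single[OF s] using s by (auto simp: polar_def intro: INF_lower)
    from subset_on_trans[OF mono[OF this] single[OF s]] show ?thesis
      using x s by (metis polar_single subset_onD)
  qed
  then show "C (polar S K f) x \<le> polar S K f x"
    by (auto simp: polar_def intro: INF_greatest)
qed

text \<open>The unit of the Galois connection places \<open>u\<close> below a polar over
  \<open>P\<close>. That polar is closed under \<open>C\<close>, so \<open>C u\<close> lies below it
  as well, and the adjunction carries this back to the transposed kernel.\<close>

lemma polar_of_closure: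
  assumes closed: "\<And>f. subset_on X (C (polar P K f)) (polar P K f)"
    and mono: "\<And>u v. subset_on X u v \<Longrightarrow> subset_on X (C u) (C v)"
  shows "subset_on P (polar X (\<lambda>x s. K s x) u) (polar X (\<lambda>x s. K s x) (C u))"
proof -
  have "subset_on X u (polar P K (polar X (\<lambda>x s. K s x) u))"
    by (rule iffD2[OF polar_adjoint subset_on_refl])
  then have "subset_on X (C u) (polar P K (polar X (\<lambda>x s. K s x) u))"
    by (rule subset_on_trans[OF mono closed])
  then show ?thesis by (rule iffD1[OF polar_adjoint])
qed


section \<open>Soundness\<close>

lemma up_polar: "up G = polar (points G) (\<lambda>z' (\<alpha>, z). edge G z' z \<rightarrow> \<alpha>)"
  by (auto simp: up_def polar_def fun_eq_iff)

lemma down_polar: "down G = polar (xpoints G) (\<lambda>(\<alpha>, z') z. edge G z z' \<rightarrow> \<alpha>)"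
  by (auto simp: down_def polar_def fun_eq_iff intro!: INF_cong)

lemma box0_polar: "box0 G = polar (xpoints G) (\<lambda>(\<alpha>, z') z. box_rel G z z' \<rightarrow> \<alpha>)"
  by (auto simp: box0_def polar_def fun_eq_iff intro!: INF_cong)

lemma box1_polar: "box1 G = polar (points G) (\<lambda>z' (\<alpha>, z). box_rel G z' z \<rightarrow> \<alpha>)"
  by (auto simp: box1_def polar_def fun_eq_iff)

lemma dia0_polar: "dia0 G = polar (points G) (\<lambda>z' (\<alpha>, z). dia_rel G z z' \<rightarrow> \<alpha>)"
  by (auto simp: dia0_def polar_def fun_eq_iff)

lemma dia1_polar: "dia1 G = polar (xpoints G) (\<lambda>(\<alpha>, z') z. dia_rel G z' z \<rightarrow> \<alpha>)"
  by (auto simp: dia1_def polar_def fun_eq_iff intro!: INF_cong)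

lemma flip_case_prod: "(\<lambda>x s. case x of (\<alpha>, z) \<Rightarrow> k s \<alpha> z) = (\<lambda>(\<alpha>, z) s. k s \<alpha> z)"
  by (auto simp: fun_eq_iff)

lemma down_up_adjoint: "subset_on (xpoints G) u (up G f) \<longleftrightarrow> subset_on (points G) f (down G u)"
  unfolding up_polar down_polar by (subst polar_adjoint) (simp add: flip_case_prod)

lemma up_antimono: "subset_on (points G) f g \<Longrightarrow> subset_on (xpoints G) (up G g) (up G f)"
  unfolding up_polar by (rule polar_antimono)

lemma down_antimono: "subset_on (xpoints G) u v \<Longrightarrow> subset_on (points G) (down G v) (down G u)"
  unfolding down_polar by (rule polar_antimono)

lemma box0_antimono: "subset_on (xpoints G) u v \<Longrightarrow> subset_on (points G) (box0 G v) (box0 G u)"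
  unfolding box0_polar by (rule polar_antimono)

lemma dia0_antimono: "subset_on (points G) f g \<Longrightarrow> subset_on (xpoints G) (dia0 G g) (dia0 G f)"
  unfolding dia0_polar by (rule polar_antimono)

lemma subset_down_up: "subset_on (points G) f (down G (up G f))"
  by (rule iffD1[OF down_up_adjoint subset_on_refl])

section \<open>Consequences of the frame conditions\<close>

context
  fixes G :: "('z, 'a::truth_values) gframe"
  assumes G: "graph_frame G"
begin

lemma box0_closed: "subset_on (points G) (down G (up G (box0 G u))) (box0 G u)"
proof -
  have "subset_on (points G) (down G (up G (box0 G (single \<beta> s)))) (box0 G (single \<beta> s))"
    if "s \<in> xpoints G" for s \<beta>
    using G that by (cases s) (simp add: graph_frame_def xpoints_def)
  then show ?thesis
    unfolding box0_polar
    by - (rule polar_closed[where C = "\<lambda>w. down G (up G w)"], simp_all add: up_antimono down_antimono)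
qed

lemma box1_closed: "subset_on (xpoints G) (up G (down G (box1 G f))) (box1 G f)"
proof -
  have "subset_on (xpoints G) (up G (down G (box1 G (single \<beta> s)))) (box1 G (single \<beta> s))"
    if "s \<in> points G" for s \<beta>
    using G that by (simp add: graph_frame_def)
  then show ?thesis
    unfolding box1_polar
    by - (rule polar_closed[where C = "\<lambda>w. up G (down G w)"], simp_all add: up_antimono down_antimono)
qed

lemma dia1_closed: "subset_on (points G) (down G (up G (dia1 G u))) (dia1 G u)"
proof -
  have "subset_on (points G) (down G (up G (dia1 G (single \<beta> s)))) (dia1 G (single \<beta> s))"
    if "s \<in> xpoints G" for s \<beta>
    using G that by (cases s) (simp add: graph_frame_def xpoints_def)
  then show ?thesis
    unfolding dia1_polar
    by - (rule polar_closed[where C = "\<lambda>w. down G (up G w)"], simp_all add: up_antimono down_antimono)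
qed

lemma dia0_closed: "subset_on (xpoints G) (up G (down G (dia0 G f))) (dia0 G f)"
proof -
  have "subset_on (xpoints G) (up G (down G (dia0 G (single \<beta> s)))) (dia0 G (single \<beta> s))"
    if "s \<in> points G" for s \<beta>
    using G that by (simp add: graph_frame_def)
  then show ?thesis
    unfolding dia0_polar
    by - (rule polar_closed[where C = "\<lambda>w. up G (down G w)"], simp_all add: up_antimono down_antimono)
qed

text \<open>Closedness of \<open>box1\<close>, the adjoint of \<open>box0\<close>, is what is
  transferred here. Together with antitonicity it makes \<open>box0\<close> depend only on the
  closure of its argument.\<close>

lemma box0_of_closure: "subset_on (points G) (box0 G u) (box0 G (up G (down G u)))"
  using polar_of_closure[OF box1_closed[unfolded box1_polar], of u]
  by (simp add: up_antimono down_antimono flip_case_prod box0_polar)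

lemma dia0_of_closure: "subset_on (xpoints G) (dia0 G f) (dia0 G (down G (up G f)))"
  using polar_of_closure[OF dia1_closed[unfolded dia1_polar], of f]
  by (simp add: up_antimono down_antimono case_prod_unfold dia0_polar)

text \<open>Under the adjunction the third inclusion says that the intension lies below
  \<open>up G\<close> of the extension, so the three together make a Galois-closed pair on the
  carrier. The frame conditions enter at \<box> and \<diamond>, through \<open>box0_closed\<close>
  and \<open>dia0_closed\<close>.\<close>

lemma interp_concept:
  assumes V: "valuation G V"
  shows "subset_on (points G) (down G (snd (interp G V \<phi>))) (fst (interp G V \<phi>)) \<and>
    subset_on (xpoints G) (up G (fst (interp G V \<phi>))) (snd (interp G V \<phi>)) \<and>
    subset_on (points G) (fst (interp G V \<phi>)) (down G (snd (interp G V \<phi>)))"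
proof (induction \<phi>)
  case FBot
  then show ?case by (simp add: Let_def) (simp add: subset_on_def)
next
  case FTop
  then show ?case by (simp add: Let_def subset_down_up) (simp add: subset_on_def)
next
  case (Atom p)
  then show ?case using V by (auto simp: valuation_def subset_on_def)
next
  case (And \<phi> \<psi>)
  let ?f = "\<lambda>z. inf (fst (interp G V \<phi>) z) (fst (interp G V \<psi>) z)"
  have "subset_on (points G) (down G (up G ?f)) (fst (interp G V \<chi>))" if "\<chi> \<in> {\<phi>, \<psi>}" for \<chi>
  proof -
    have "subset_on (points G) ?f (fst (interp G V \<chi>))"
      using that by (auto simp: subset_on_def)
    then have "subset_on (points G) (down G (up G ?f)) (down G (up G (fst (interp G V \<chi>))))"
      by (simp add: up_antimono down_antimono)
    moreover have "subset_on (points G) (down G (up G (fst (interp G V \<chi>)))) (down G (snd (interp G V \<chi>)))"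
      using And that by (auto intro!: down_antimono iffD2[OF down_up_adjoint])
    moreover have "subset_on (points G) (down G (snd (interp G V \<chi>))) (fst (interp G V \<chi>))"
      using And that by auto
    ultimately show ?thesis by (rule subset_on_trans[OF subset_on_trans])
  qed
  then show ?case by (simp add: Let_def subset_down_up subset_on_inf)
next
  case (Or \<phi> \<psi>)
  let ?u = "\<lambda>x. inf (snd (interp G V \<phi>) x) (snd (interp G V \<psi>) x)"
  have "subset_on (xpoints G) (up G (down G ?u)) (snd (interp G V \<chi>))" if "\<chi> \<in> {\<phi>, \<psi>}" for \<chi>
  proof -
    have "subset_on (xpoints G) ?u (snd (interp G V \<chi>))"
      using that by (auto simp: subset_on_def)
    then have "subset_on (xpoints G) (up G (down G ?u)) (up G (down G (snd (interp G V \<chi>))))"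
      by (simp add: up_antimono down_antimono)
    moreover have "subset_on (xpoints G) (up G (down G (snd (interp G V \<chi>)))) (up G (fst (interp G V \<chi>)))"
      using Or that by (auto intro: up_antimono)
    moreover have "subset_on (xpoints G) (up G (fst (interp G V \<chi>))) (snd (interp G V \<chi>))"
      using Or that by auto
    ultimately show ?thesis by (rule subset_on_trans[OF subset_on_trans])
  qed
  then show ?case by (simp add: Let_def subset_on_inf)
next
  case (Box \<phi>)
  then show ?case by (simp add: Let_def box0_closed subset_down_up)
next
  case (Dia \<phi>)
  then show ?case by (simp add: Let_def dia0_closed)
qed

lemma valuation_interp:
  assumes V: "valuation G V"
  shows "valuation G (\<lambda>p. interp G V (\<sigma> p))"
  unfolding valuation_def
proof (intro allI conjI ballI)
  fix p
  show "up G (fst (interp G V (\<sigma> p))) x = snd (interp G V (\<sigma> p)) x" if "x \<in> xpoints G" for x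
    using interp_concept[OF V, of "\<sigma> p"] that
    by (intro antisym) (auto simp: subset_onD simp flip: down_up_adjoint)
  show "down G (snd (interp G V (\<sigma> p))) z = fst (interp G V (\<sigma> p)) z" if "z \<in> points G" for z
    using interp_concept[OF V, of "\<sigma> p"] that by (intro antisym) (auto simp: subset_onD)
qed

text \<open>Formulas built by \<bottom>, \<or> and \<diamond> are defined through their intensions,
  for which this reversed test is the direct one.\<close>

lemma true_in_iff_snd:
  assumes V: "valuation G V"
  shows "true_in G V (\<phi>, \<psi>) \<longleftrightarrow>
    subset_on (xpoints G) (snd (interp G V \<psi>)) (snd (interp G V \<phi>))"
proof
  assume "true_in G V (\<phi>, \<psi>)"
  then have "subset_on (xpoints G) (up G (fst (interp G V \<psi>))) (up G (fst (interp G V \<phi>)))"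
    by (simp add: true_in_def up_antimono)
  then show "subset_on (xpoints G) (snd (interp G V \<psi>)) (snd (interp G V \<phi>))"
    using interp_concept[OF V] by (meson down_up_adjoint subset_on_trans)
next
  assume "subset_on (xpoints G) (snd (interp G V \<psi>)) (snd (interp G V \<phi>))"
  then have "subset_on (points G) (down G (snd (interp G V \<phi>))) (down G (snd (interp G V \<psi>)))"
    by (rule down_antimono)
  then show "true_in G V (\<phi>, \<psi>)"
    unfolding true_in_def fst_conv snd_conv using interp_concept[OF V] by (meson subset_on_trans)
qed

text \<open>\<open>box0\<close> turns the join \<open>?w\<close> of the two intensions into the meet
  of the boxed extensions. Since \<open>down G ?w\<close> lies below the extension of the
  conjunction, closing \<open>?w\<close> first lets antitonicity finish.\<close>

lemma true_in_box_and:
  assumes V: "valuation G V"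
  shows "true_in G V (And (Box \<phi>) (Box \<psi>), Box (And \<phi> \<psi>))"
proof -
  let ?f = "fst (interp G V \<phi>)" and ?g = "fst (interp G V \<psi>)"
  let ?u = "snd (interp G V \<phi>)" and ?v = "snd (interp G V \<psi>)"
  let ?w = "\<lambda>x. sup (?u x) (?v x)"
  have "subset_on (points G) (down G ?w) (\<lambda>z. inf (?f z) (?g z))"
    using interp_concept[OF V, of \<phi>] interp_concept[OF V, of \<psi>]
    unfolding down_polar polar_sup by (blast intro: subset_on_inf_mono)
  then have "subset_on (points G) (box0 G (up G (down G ?w))) (box0 G (up G (\<lambda>z. inf (?f z) (?g z))))"
    by (intro box0_antimono up_antimono)
  from subset_on_trans[OF box0_of_closure this]
  show ?thesis by (simp add: true_in_def Let_def box0_polar polar_sup)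
qed

lemma true_in_dia_or:
  assumes V: "valuation G V"
  shows "true_in G V (Dia (Or \<phi> \<psi>), Or (Dia \<phi>) (Dia \<psi>))"
proof -
  let ?f = "fst (interp G V \<phi>)" and ?g = "fst (interp G V \<psi>)"
  let ?u = "snd (interp G V \<phi>)" and ?v = "snd (interp G V \<psi>)"
  let ?h = "\<lambda>z. sup (?f z) (?g z)"
  have "subset_on (xpoints G) (up G ?h) (\<lambda>z. inf (?u z) (?v z))"
    using interp_concept[OF V, of \<phi>] interp_concept[OF V, of \<psi>]
    unfolding up_polar polar_sup by (blast intro: subset_on_inf_mono)
  then have "subset_on (xpoints G) (dia0 G (down G (up G ?h))) (dia0 G (down G (\<lambda>z. inf (?u z) (?v z))))"
    by (intro dia0_antimono down_antimono)
  from down_antimono[OF subset_on_trans[OF dia0_of_closure this]]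
  show ?thesis by (simp add: true_in_def Let_def dia0_polar polar_sup)
qed

text \<open>The empty case of the same argument: the constant \<open>bot\<close> replaces the join
  of two intensions.\<close>

lemma true_in_box_top: "true_in G V (FTop, Box FTop)"
proof -
  have "subset_on (points G) (box0 G (up G (down G (\<lambda>_. bot)))) (box0 G (up G (\<lambda>_. top)))"
    by (intro box0_antimono up_antimono) (simp add: subset_on_def)
  from subset_on_trans[OF box0_of_closure this]
  show ?thesis by (simp add: true_in_def Let_def box0_polar polar_bot)
qed

lemma true_in_dia_bot: "true_in G V (Dia FBot, FBot)"
proof -
  have "subset_on (xpoints G) (dia0 G (down G (up G (\<lambda>_. bot)))) (dia0 G (down G (\<lambda>_. top)))"
    by (intro dia0_antimono down_antimono) (simp add: subset_on_def)
  from down_antimono[OF subset_on_trans[OF dia0_of_closure this]]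
  show ?thesis by (simp add: true_in_def Let_def dia0_polar polar_bot)
qed

end

lemma interp_fm_subst: "interp G V (fm_subst \<sigma> \<phi>) = interp G (\<lambda>p. interp G V (\<sigma> p)) \<phi>"
  by (induction \<phi>) (simp_all add: Let_def)

lemma logic_sound:
  assumes G: "G \<in> frame_class \<Gamma>" and "s \<in> logic \<Gamma>"
  shows "valid G s"
proof -
  have gf: "graph_frame G" using G by (simp add: frame_class_def)
  note snd_iff = true_in_iff_snd[OF gf]
  from assms(2) have "true_in G V s" if "valuation G V" for V
    using that
  \<comment> \<open>The substitution rule passes to the valuation
    \<open>\<lambda>p. interp G V (\<sigma> p)\<close>, so the induction hypothesis must cover all
    valuations.\<close>
  proof (induction arbitrary: V)
    case (extra s)
    then show ?case using G by (auto simp: frame_class_def valid_def)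
  next
    case (ax_bot p)
    then show ?case by (simp add: snd_iff Let_def) (simp add: subset_on_def)
  next
    case (ax_or1 p q)
    then show ?case by (simp add: snd_iff Let_def) (simp add: subset_on_def)
  next
    case (ax_or2 q p)
    then show ?case by (simp add: snd_iff Let_def) (simp add: subset_on_def)
  next
    case (cut \<phi> \<chi> \<psi>)
    then show ?case by (auto simp: true_in_def intro: subset_on_trans)
  next
    case (subst \<phi> \<psi> \<sigma>)
    from subst.IH[OF valuation_interp[OF gf subst.prems]] show ?case
      by (simp add: true_in_def interp_fm_subst)
  next
    case (or_elim \<phi> \<chi> \<psi>)
    then show ?case by (simp add: snd_iff Let_def subset_on_inf)
  next
    case (box_mono \<phi> \<psi>)
    then have "subset_on (xpoints G) (snd (interp G V \<psi>)) (snd (interp G V \<phi>))"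
      by (simp add: snd_iff)
    then show ?case by (simp add: true_in_def Let_def box0_antimono)
  next
    case (dia_mono \<phi> \<psi>)
    then show ?case by (simp add: true_in_def Let_def dia0_antimono down_antimono)
  qed (simp_all add: true_in_box_and[OF gf] true_in_dia_or[OF gf] true_in_box_top[OF gf]
      true_in_dia_bot[OF gf], simp_all add: true_in_def Let_def subset_on_def)
  then show ?thesis by (simp add: valid_def)
qed


section \<open>Boolean evaluations\<close>

text \<open>The flag \<open>d\<close> makes \<diamond> the identity or constantly false. Either
  choice validates both logics; each of the two facts about derivability below needs a different
  one.\<close>

primrec beval :: "bool \<Rightarrow> ('p \<Rightarrow> bool) \<Rightarrow> 'p fm \<Rightarrow> bool" where
  "beval d v FBot = False"
| "beval d v FTop = True"
| "beval d v (Atom p) = v p"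
| "beval d v (And \<phi> \<psi>) = (beval d v \<phi> \<and> beval d v \<psi>)"
| "beval d v (Or \<phi> \<psi>) = (beval d v \<phi> \<or> beval d v \<psi>)"
| "beval d v (Box \<phi>) = beval d v \<phi>"
| "beval d v (Dia \<phi>) = (d \<and> beval d v \<phi>)"

lemma beval_fm_subst: "beval d v (fm_subst \<sigma> \<phi>) = beval d (\<lambda>p. beval d v (\<sigma> p)) \<phi>"
  by (induction \<phi>) simp_all

abbreviation derives :: "nat \<Rightarrow> 'p fm \<Rightarrow> 'p fm \<Rightarrow> bool" where
  "derives i \<phi> \<psi> \<equiv> (\<phi>, \<psi>) \<in> logic (extra_axioms i)"

lemma beval_sound:
  assumes "derives i \<phi> \<psi>" "beval d v \<phi>"
  shows "beval d v \<psi>"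
proof -
  have "beval d v (fst s) \<Longrightarrow> beval d v (snd s)" if "s \<in> logic (extra_axioms i)" for s
    using that
    by (induction arbitrary: v)
      (auto simp: extra_axioms_def beval_fm_subst split: if_splits)
  from this[OF assms(1)] assms(2) show ?thesis by simp
qed

lemma derives_box_bot: "derives i (Box FBot) FBot"
proof (cases "i = 0")
  case False
  then have "derives i (Box (Atom undefined)) (Atom undefined)"
    by (intro logic.extra) (simp add: extra_axioms_def)
  from logic.subst[OF this, of "\<lambda>_. FBot"] show ?thesis by simp
qed (simp add: logic.extra extra_axioms_def)

lemma derives_box_elim:
  assumes "i \<noteq> 0"
  shows "derives i (Box \<phi>) \<phi>"
proof -
  have "derives i (Box (Atom undefined)) (Atom undefined)"
    using assms by (intro logic.extra) (simp add: extra_axioms_def)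
  from logic.subst[OF this, of "\<lambda>_. \<phi>"] show ?thesis by simp
qed

text \<open>With all atoms and diamonds false, a true disjunction owes its truth to one disjunct, so
  truth propagates to provability from \<top>. As \<box> is the identity here,
  \<open>Box \<phi>\<close> is provable from \<top> exactly if \<open>\<phi>\<close> is.\<close>

lemma derives_top_iff: "derives i FTop \<phi> \<longleftrightarrow> beval False (\<lambda>_. False) \<phi>"
proof
  show "beval False (\<lambda>_. False) \<phi>" if "derives i FTop \<phi>"
    using beval_sound[OF that] by simp
  show "derives i FTop \<phi>" if "beval False (\<lambda>_. False) \<phi>"
    using that by (induction \<phi>) (auto intro: logic.intros)
qed

text \<open>Dually, with all atoms true and \<diamond> the identity, a false formula collapses to
  \<bottom>; a boxed one does so through \<open>Box FBot\<close>. Hence \<open>Dia \<phi>\<close>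
  derives \<bottom> exactly if \<open>\<phi>\<close> does.\<close>

lemma derives_bot_iff: "derives i \<phi> FBot \<longleftrightarrow> \<not> beval True (\<lambda>_. True) \<phi>"
proof
  show "\<not> beval True (\<lambda>_. True) \<phi>" if "derives i \<phi> FBot"
    using beval_sound[OF that] by auto
  show "derives i \<phi> FBot" if "\<not> beval True (\<lambda>_. True) \<phi>"
    using that
    by (induction \<phi>) (auto intro: logic.intros derives_box_bot)
qed


section \<open>The canonical frame\<close>

definition logic_filter :: "nat \<Rightarrow> 'p fm set \<Rightarrow> bool" where
  "logic_filter i F \<longleftrightarrow> FTop \<in> F \<and> (\<forall>\<phi> \<psi>. \<phi> \<in> F \<longrightarrow> derives i \<phi> \<psi> \<longrightarrow> \<psi> \<in> F) \<and>
     (\<forall>\<phi> \<psi>. \<phi> \<in> F \<longrightarrow> \<psi> \<in> F \<longrightarrow> And \<phi> \<psi> \<in> F)"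

text \<open>The conditions of an ideal, read contrapositively on its complement: closure under joins
  becomes primeness. Disjointness of a filter from an ideal thereby becomes inclusion.\<close>

definition logic_coideal :: "nat \<Rightarrow> 'p fm set \<Rightarrow> bool" where
  "logic_coideal i J \<longleftrightarrow> FBot \<notin> J \<and> (\<forall>\<phi> \<psi>. \<phi> \<in> J \<longrightarrow> derives i \<phi> \<psi> \<longrightarrow> \<psi> \<in> J) \<and>
     (\<forall>\<phi> \<psi>. Or \<phi> \<psi> \<in> J \<longrightarrow> \<phi> \<in> J \<or> \<psi> \<in> J)"

text \<open>
  The components of a point encode sets of formulas; values other than \<open>top\<close> are not
  distinguished, so the frame contains harmless duplicates of points.
\<close>

definition Fset :: "('p, 'a::truth_values) canonical_points \<Rightarrow> 'p fm set" where
  "Fset z = {\<phi>. fst z \<phi> = top}"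

definition Jset :: "('p, 'a::truth_values) canonical_points \<Rightarrow> 'p fm set" where
  "Jset z = {\<phi>. snd z \<phi> = top}"

definition crisp :: "bool \<Rightarrow> 'a::truth_values" where
  "crisp b = (if b then top else bot)"

text \<open>\<open>dia_rel\<close> takes the coideal from its first and the filter from its second
  argument, in line with the order of arguments in \<open>dia0\<close>.\<close>

definition canonical_frame :: "nat \<Rightarrow> (('p, 'a::truth_values) canonical_points, 'a) gframe" where
  "canonical_frame i =
    \<lparr>points = {z. logic_filter i (Fset z) \<and> logic_coideal i (Jset z) \<and> Fset z \<subseteq> Jset z},
     edge = (\<lambda>z z'. crisp (Fset z \<subseteq> Jset z')),
     dia_rel = (\<lambda>z z'. crisp (\<forall>\<phi>\<in>Fset z'. Dia \<phi> \<in> Jset z)),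
     box_rel = (\<lambda>z z'. crisp (\<forall>\<phi>. Box \<phi> \<in> Fset z \<longrightarrow> \<phi> \<in> Jset z'))\<rparr>"

lemma points_canonical:
  "z \<in> points (canonical_frame i) \<longleftrightarrow>
     logic_filter i (Fset z) \<and> logic_coideal i (Jset z) \<and> Fset z \<subseteq> Jset z"
  by (simp add: canonical_frame_def)

lemma canonical_point_exists:
  assumes "logic_filter i F" "logic_coideal i J" "F \<subseteq> J"
  shows "\<exists>z \<in> points (canonical_frame i). Fset z = F \<and> Jset z = J"
  using assms bot_neq_top
  by (intro bexI[of _ "(\<lambda>\<phi>. crisp (\<phi> \<in> F), \<lambda>\<phi>. crisp (\<phi> \<in> J))"])
    (auto simp: points_canonical Fset_def Jset_def crisp_def)

lemma logic_filter_principal: "logic_filter i {\<psi>. derives i \<phi> \<psi>}"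
  unfolding logic_filter_def by (blast intro: logic.intros)

lemma logic_coideal_principal:
  "logic_coideal i {\<psi>. \<not> derives i \<psi> \<phi>}"
  unfolding logic_coideal_def by (blast intro: logic.intros)

text \<open>The partner of \<open>F\<close> is the largest coideal, the formulas that do not derive
  \<bottom>.\<close>

lemma consistent_filter_point:
  assumes "logic_filter i F" "FBot \<notin> F"
  shows "\<exists>z \<in> points (canonical_frame i). Fset z = F"
  using canonical_point_exists[OF assms(1) logic_coideal_principal[of i FBot]] assms
  by (auto simp: logic_filter_def)

text \<open>The partner of \<open>J\<close> is the least filter, the consequences of \<top>.\<close>

lemma full_coideal_point:
  assumes "logic_coideal i J" "FTop \<in> J"
  shows "\<exists>z \<in> points (canonical_frame i). Jset z = J"
  using canonical_point_exists[OF logic_filter_principal[of i FTop] assms(1)] assms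
  by (auto simp: logic_coideal_def)

lemma
  assumes "z \<in> points (canonical_frame i)"
  shows Fset_top: "FTop \<in> Fset z"
    and Fset_mono: "\<phi> \<in> Fset z \<Longrightarrow> derives i \<phi> \<psi> \<Longrightarrow> \<psi> \<in> Fset z"
    and Fset_and: "\<phi> \<in> Fset z \<Longrightarrow> \<psi> \<in> Fset z \<Longrightarrow> And \<phi> \<psi> \<in> Fset z"
    and Jset_bot: "FBot \<notin> Jset z"
    and Jset_mono: "\<phi> \<in> Jset z \<Longrightarrow> derives i \<phi> \<psi> \<Longrightarrow> \<psi> \<in> Jset z"
    and Jset_or: "Or \<phi> \<psi> \<in> Jset z \<Longrightarrow> \<phi> \<in> Jset z \<or> \<psi> \<in> Jset z"
    and Fset_Jset: "\<phi> \<in> Fset z \<Longrightarrow> \<phi> \<in> Jset z"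
  using assms unfolding points_canonical logic_filter_def logic_coideal_def by blast+

section \<open>Principal filters and ideals as witnesses\<close>

lemma principal_filter_point:
  assumes "\<not> derives i \<phi> FBot"
  shows "\<exists>z \<in> points (canonical_frame i). Fset z = {\<psi>. derives i \<phi> \<psi>}"
  using consistent_filter_point[OF logic_filter_principal] assms by auto

lemma principal_coideal_point:
  assumes "\<not> derives i FTop \<phi>"
  shows "\<exists>z \<in> points (canonical_frame i). Jset z = {\<psi>. \<not> derives i \<psi> \<phi>}"
  using full_coideal_point[OF logic_coideal_principal] assms by auto

text \<open>The left side is what the infimum defining \<open>up\<close> detects at
  \<open>z\<close>, and the filter generated by \<open>\<phi>\<close> is the witness. The next three
  equivalences serve \<open>dia0\<close>, \<open>down\<close> and \<open>box0\<close>, the last two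
  with the complement of the ideal generated by \<open>\<phi>\<close>.\<close>

lemma Jset_iff:
  fixes z :: "('p, 'a::truth_values) canonical_points"
  assumes z: "z \<in> points (canonical_frame i)"
  shows "(\<exists>z'\<in>points (canonical_frame i :: (('p, 'a) canonical_points, 'a) gframe).
      \<phi> \<in> Fset z' \<and> Fset z' \<subseteq> Jset z)
    \<longleftrightarrow> \<phi> \<in> Jset z"
    (is "?L \<longleftrightarrow> _")
proof
  assume \<phi>: "\<phi> \<in> Jset z"
  then have "\<not> derives i \<phi> FBot" using Jset_mono[OF z] Jset_bot[OF z] by blast
  from principal_filter_point[OF this] obtain z' :: "('p, 'a) canonical_points"
    where "z' \<in> points (canonical_frame i)" "Fset z' = {\<psi>. derives i \<phi> \<psi>}" by metis
  then show ?L
    using Jset_mono[OF z \<phi>] by (auto intro: logic.ax_id)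
qed auto

lemma Dia_Jset_iff:
  fixes z :: "('p, 'a::truth_values) canonical_points"
  assumes z: "z \<in> points (canonical_frame i)"
  shows "(\<exists>z'\<in>points (canonical_frame i :: (('p, 'a) canonical_points, 'a) gframe).
      \<phi> \<in> Fset z' \<and> (\<forall>\<psi>\<in>Fset z'. Dia \<psi> \<in> Jset z))
    \<longleftrightarrow> Dia \<phi> \<in> Jset z"
    (is "?L \<longleftrightarrow> _")
proof
  assume \<phi>: "Dia \<phi> \<in> Jset z"
  then have "\<not> derives i \<phi> FBot"
    using Jset_mono[OF z] Jset_bot[OF z] by (blast intro: logic.intros)
  from principal_filter_point[OF this] obtain z' :: "('p, 'a) canonical_points"
    where "z' \<in> points (canonical_frame i)" "Fset z' = {\<psi>. derives i \<phi> \<psi>}" by metis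
  then show ?L
    using Jset_mono[OF z \<phi>] by (auto intro: logic.ax_id logic.dia_mono)
qed auto

lemma Fset_iff:
  fixes z :: "('p, 'a::truth_values) canonical_points"
  assumes z: "z \<in> points (canonical_frame i)"
  shows "(\<exists>z'\<in>points (canonical_frame i :: (('p, 'a) canonical_points, 'a) gframe).
      Fset z \<subseteq> Jset z' \<and> \<phi> \<notin> Jset z')
    \<longleftrightarrow> \<phi> \<notin> Fset z"
    (is "?L \<longleftrightarrow> _")
proof
  assume \<phi>: "\<phi> \<notin> Fset z"
  then have "\<not> derives i FTop \<phi>" using Fset_mono[OF z] Fset_top[OF z] by blast
  from principal_coideal_point[OF this] obtain z' :: "('p, 'a) canonical_points"
    where "z' \<in> points (canonical_frame i)" "Jset z' = {\<psi>. \<not> derives i \<psi> \<phi>}" by metis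
  then show ?L
    using Fset_mono[OF z] \<phi> by (auto intro: logic.ax_id)
qed auto

lemma Box_Fset_iff:
  fixes z :: "('p, 'a::truth_values) canonical_points"
  assumes z: "z \<in> points (canonical_frame i)"
  shows "(\<exists>z'\<in>points (canonical_frame i :: (('p, 'a) canonical_points, 'a) gframe).
      (\<forall>\<psi>. Box \<psi> \<in> Fset z \<longrightarrow> \<psi> \<in> Jset z') \<and> \<phi> \<notin> Jset z')
    \<longleftrightarrow> Box \<phi> \<notin> Fset z"
    (is "?L \<longleftrightarrow> _")
proof
  assume \<phi>: "Box \<phi> \<notin> Fset z"
  \<comment> \<open>Otherwise \<top> \<turnstile> \<box>\<top> \<turnstile> \<box>\<phi> would put
    \<open>Box \<phi>\<close> into the filter.\<close>
  then have "\<not> derives i FTop \<phi>"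
    using Fset_mono[OF z] Fset_top[OF z] by (blast intro: logic.intros)
  from principal_coideal_point[OF this] obtain z' :: "('p, 'a) canonical_points"
    where "z' \<in> points (canonical_frame i)" "Jset z' = {\<psi>. \<not> derives i \<psi> \<phi>}" by metis
  then show ?L
    using Fset_mono[OF z _ logic.box_mono] \<phi> by (intro bexI[of _ z']) (auto intro: logic.ax_id)
qed auto


subsection \<open>Frame conditions\<close>

lemma box_column:
  fixes z :: "('p, 'a::truth_values) canonical_points"
  assumes z: "z \<in> points (canonical_frame i)"
  shows "\<exists>z'\<in>points (canonical_frame i). \<forall>z1\<in>points (canonical_frame i).
    box_rel (canonical_frame i) z1 z = edge (canonical_frame i) z1 z'"
proof -
  \<comment> \<open>The complement of the ideal generated by all \<open>Box \<phi>\<close> with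
    \<open>\<phi>\<close> outside \<open>Jset z\<close>.\<close>
  let ?J = "{\<psi>. \<forall>\<phi>. derives i \<psi> (Box \<phi>) \<longrightarrow> \<phi> \<in> Jset z}"
  have prime: "\<phi> \<in> ?J \<or> \<psi> \<in> ?J" if "Or \<phi> \<psi> \<in> ?J" for \<phi> \<psi>
  proof (rule ccontr)
    assume "\<not> ?thesis"
    then obtain \<phi>' \<psi>' where *: "derives i \<phi> (Box \<phi>')" "derives i \<psi> (Box \<psi>')"
      "\<phi>' \<notin> Jset z" "\<psi>' \<notin> Jset z" by blast
    have "derives i (Or \<phi> \<psi>) (Box (Or \<phi>' \<psi>'))"
      by (rule logic.or_elim[OF logic.cut[OF *(1) logic.box_mono[OF logic.ax_or1]]
            logic.cut[OF *(2) logic.box_mono[OF logic.ax_or2]]])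
    with that * Jset_or[OF z] show False by blast
  qed
  have "logic_coideal i ?J"
    unfolding logic_coideal_def
  proof (intro conjI allI impI prime)
    show "FBot \<notin> ?J" using Jset_bot[OF z] logic.ax_bot by blast
    show "\<psi> \<in> ?J" if "\<phi> \<in> ?J" "derives i \<phi> \<psi>" for \<phi> \<psi>
      using that(1) logic.cut[OF that(2)] by blast
  qed
  \<comment> \<open>By \<open>derives_top_iff\<close>, \<top> \<turnstile> \<box>\<phi> forces
    \<top> \<turnstile> \<phi>, and \<open>Jset z\<close> contains all consequences of
    \<top>.\<close>
  moreover have "FTop \<in> ?J"
    using Jset_mono[OF z Fset_Jset[OF z Fset_top[OF z]]]
    by (simp add: derives_top_iff)
  ultimately obtain z' :: "('p, 'a) canonical_points"
    where z': "z' \<in> points (canonical_frame i)" "Jset z' = ?J"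
    using full_coideal_point[of i ?J] by blast
  have "(\<forall>\<phi>. Box \<phi> \<in> Fset z1 \<longrightarrow> \<phi> \<in> Jset z) \<longleftrightarrow> Fset z1 \<subseteq> ?J"
    if "z1 \<in> points (canonical_frame i)" for z1 :: "('p, 'a) canonical_points"
    using Fset_mono[OF that] by (blast intro: logic.ax_id)
  with z' show ?thesis
    by (intro bexI[of _ z']) (simp_all add: canonical_frame_def)
qed

lemma box_row:
  fixes z :: "('p, 'a::truth_values) canonical_points"
  assumes z: "z \<in> points (canonical_frame i)"
  shows "\<exists>z'\<in>points (canonical_frame i). \<forall>z1\<in>points (canonical_frame i).
    box_rel (canonical_frame i) z z1 = edge (canonical_frame i) z' z1"
proof -
  let ?F = "{\<psi>. Box \<psi> \<in> Fset z}"
  have "logic_filter i ?F"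
    unfolding logic_filter_def
    using Fset_mono[OF z Fset_top[OF z] logic.ax_box_top] Fset_mono[OF z _ logic.box_mono]
      Fset_mono[OF z Fset_and[OF z] logic.ax_box_and] by blast
  \<comment> \<open>Consistency of the pulled-back filter rests on \<box>\<bottom> \<turnstile>
    \<bottom>.\<close>
  moreover have "FBot \<notin> ?F"
    using Fset_mono[OF z _ derives_box_bot] Fset_Jset[OF z] Jset_bot[OF z] by blast
  ultimately obtain z' :: "('p, 'a) canonical_points"
    where z': "z' \<in> points (canonical_frame i)" "Fset z' = ?F"
    using consistent_filter_point[of i ?F] by blast
  then show ?thesis
    by (intro bexI[of _ z']) (auto simp: canonical_frame_def subset_eq)
qed

lemma dia_column:
  fixes z :: "('p, 'a::truth_values) canonical_points"
  assumes z: "z \<in> points (canonical_frame i)"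
  shows "\<exists>z'\<in>points (canonical_frame i). \<forall>z1\<in>points (canonical_frame i).
    dia_rel (canonical_frame i) z1 z = edge (canonical_frame i) z' z1"
proof -
  \<comment> \<open>The filter generated by all \<open>Dia \<phi>\<close> with \<open>\<phi>\<close>
    in \<open>Fset z\<close>.\<close>
  let ?F = "{\<psi>. \<exists>\<phi>\<in>Fset z. derives i (Dia \<phi>) \<psi>}"
  have meet: "And \<phi> \<psi> \<in> ?F" if "\<phi> \<in> ?F" "\<psi> \<in> ?F" for \<phi> \<psi>
  proof -
    from that obtain \<phi>' \<psi>' where *: "derives i (Dia \<phi>') \<phi>" "derives i (Dia \<psi>') \<psi>"
      "\<phi>' \<in> Fset z" "\<psi>' \<in> Fset z" by blast
    have "derives i (Dia (And \<phi>' \<psi>')) (And \<phi> \<psi>)"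
      by (rule logic.and_intro[OF logic.cut[OF logic.dia_mono[OF logic.ax_and1] *(1)]
            logic.cut[OF logic.dia_mono[OF logic.ax_and2] *(2)]])
    with * Fset_and[OF z] show ?thesis by blast
  qed
  have "logic_filter i ?F"
    unfolding logic_filter_def
  proof (intro conjI allI impI meet)
    show "FTop \<in> ?F" using Fset_top[OF z] logic.ax_top by blast
    show "\<psi> \<in> ?F" if "\<phi> \<in> ?F" "derives i \<phi> \<psi>" for \<phi> \<psi>
      using that(1) logic.cut[OF _ that(2)] by blast
  qed
  \<comment> \<open>\<diamond> is the identity in the evaluation behind
    \<open>derives_bot_iff\<close>. This keeps the generated filter consistent.\<close>
  moreover have "derives i \<phi> FBot" if "derives i (Dia \<phi>) FBot" for \<phi>
    using that by (simp add: derives_bot_iff)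
  then have "FBot \<notin> ?F"
    using Fset_mono[OF z] Fset_Jset[OF z] Jset_bot[OF z] by blast
  ultimately obtain z' :: "('p, 'a) canonical_points"
    where z': "z' \<in> points (canonical_frame i)" "Fset z' = ?F"
    using consistent_filter_point[of i ?F] by blast
  have "(\<forall>\<phi>\<in>Fset z. Dia \<phi> \<in> Jset z1) \<longleftrightarrow> ?F \<subseteq> Jset z1"
    if "z1 \<in> points (canonical_frame i)" for z1 :: "('p, 'a) canonical_points"
    using Jset_mono[OF that] by (blast intro: logic.ax_id)
  with z' show ?thesis
    by (intro bexI[of _ z']) (simp_all add: canonical_frame_def)
qed

text \<open>The pullback of \<open>Jset z\<close> along \<diamond> is a coideal, but it belongs to a
  point only if it contains \<top>. If it does not, then \<open>Dia FTop\<close> lies outside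
  \<open>Jset z\<close> while every filter contains \<top>, so the row vanishes.\<close>

lemma dia_row:
  fixes z :: "('p, 'a::truth_values) canonical_points"
  assumes z: "z \<in> points (canonical_frame i)"
  shows "(\<forall>z1\<in>points (canonical_frame i). dia_rel (canonical_frame i) z z1 = bot) \<or>
    (\<exists>z'\<in>points (canonical_frame i). \<forall>z1\<in>points (canonical_frame i).
    dia_rel (canonical_frame i) z z1 = edge (canonical_frame i) z1 z')"
proof (cases "Dia FTop \<in> Jset z")
  case True
  let ?J = "{\<psi>. Dia \<psi> \<in> Jset z}"
  have "logic_coideal i ?J"
    unfolding logic_coideal_def
    using Jset_mono[OF z _ logic.ax_dia_bot] Jset_bot[OF z] Jset_mono[OF z _ logic.dia_mono]
      Jset_or[OF z Jset_mono[OF z _ logic.ax_dia_or]] by blast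
  with True obtain z' :: "('p, 'a) canonical_points"
    where z': "z' \<in> points (canonical_frame i)" "Jset z' = ?J"
    using full_coideal_point[of i ?J] by blast
  then show ?thesis
    by (intro disjI2 bexI[of _ z']) (auto simp: canonical_frame_def subset_eq)
next
  case False
  then show ?thesis
    using Fset_top by (auto simp: canonical_frame_def crisp_def logic_filter_def)
qed

text \<open>On the carrier \<open>g\<close> is \<open>down G\<close> of a singleton, and every value
  of \<open>down G\<close> is fixed by the closure. Thus a frame condition holds once the relevant
  row or column of a modal relation is one of the edge relation.\<close>

lemma down_up_edge:
  assumes z': "z' \<in> points G"
    and g: "\<And>z. z \<in> points G \<Longrightarrow> g z = (\<beta> \<rightarrow> (edge G z z' \<rightarrow> \<alpha>))"
  shows "subset_on (points G) (down G (up G g)) g"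
proof -
  let ?u = "single \<beta> (\<alpha>, z')"
  have g': "g z = down G ?u z" if "z \<in> points G" for z
    using that z' g by (simp add: down_polar polar_single xpoints_def)
  then have "subset_on (xpoints G) ?u (up G g)"
    unfolding down_up_adjoint by (simp add: subset_on_def)
  then show ?thesis
    using g' down_antimono[of G ?u "up G g"] by (simp add: subset_on_def)
qed

lemma up_down_edge:
  assumes z': "z' \<in> points G"
    and u: "\<And>\<alpha> z. z \<in> points G \<Longrightarrow> u (\<alpha>, z) = (\<beta> \<rightarrow> (edge G z' z \<rightarrow> \<alpha>))"
  shows "subset_on (xpoints G) (up G (down G u)) u"
proof -
  let ?f = "single \<beta> z'"
  have u': "u x = up G ?f x" if "x \<in> xpoints G" for x
    using that z' u by (auto simp add: up_polar polar_single xpoints_def)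
  then have "subset_on (points G) ?f (down G u)"
    by (intro iffD1[OF down_up_adjoint]) (simp add: subset_on_def)
  then show ?thesis
    using u' up_antimono[of G ?f "down G u"] by (simp add: subset_on_def)
qed

lemma graph_frame_canonical:
  "graph_frame (canonical_frame i :: (('p, 'a::truth_values) canonical_points, 'a) gframe)"
  (is "graph_frame ?G")
  unfolding graph_frame_def
proof (intro conjI ballI allI)
  have "\<not> derives i (FTop :: 'p fm) FBot" by (simp add: derives_bot_iff)
  from principal_filter_point[OF this] show "points ?G \<noteq> {}" by blast
next
  fix z assume z: "z \<in> points ?G"
  then show "edge ?G z z = top" by (simp add: canonical_frame_def crisp_def)
  fix \<alpha> \<beta> :: 'a
  have x: "(\<alpha>, z) \<in> xpoints ?G" using z by (simp add: xpoints_def)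
  show "subset_on (points ?G) (down ?G (up ?G (box0 ?G (single \<beta> (\<alpha>, z)))))
      (box0 ?G (single \<beta> (\<alpha>, z)))"
    using box_column[OF z] by (auto intro: down_up_edge simp: box0_polar polar_single[OF x])
  show "subset_on (xpoints ?G) (up ?G (down ?G (box1 ?G (single \<beta> z)))) (box1 ?G (single \<beta> z))"
    using box_row[OF z] by (auto intro: up_down_edge simp: box1_polar polar_single[OF z])
  show "subset_on (xpoints ?G) (up ?G (down ?G (dia0 ?G (single \<beta> z)))) (dia0 ?G (single \<beta> z))"
    using dia_column[OF z] by (auto intro: up_down_edge simp: dia0_polar polar_single[OF z])
  show "subset_on (points ?G) (down ?G (up ?G (dia1 ?G (single \<beta> (\<alpha>, z)))))
      (dia1 ?G (single \<beta> (\<alpha>, z)))"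
    using dia_row[OF z]
  proof
    assume "\<forall>z1\<in>points ?G. dia_rel ?G z z1 = bot"
    then have "dia1 ?G (single \<beta> (\<alpha>, z)) z1 = top" if "z1 \<in> points ?G" for z1
      using that by (simp add: dia1_polar polar_single[OF x])
    then show ?thesis by (simp add: subset_on_def)
  qed (auto intro: down_up_edge simp: dia1_polar polar_single[OF x])
qed


subsection \<open>Truth lemma\<close>

definition canon_ext :: "'p fm \<Rightarrow> ('p, 'a::truth_values) canonical_points \<Rightarrow> 'a" where
  "canon_ext \<phi> z = crisp (\<phi> \<in> Fset z)"

text \<open>The value of \<open>up\<close> on a crisp extension: \<open>\<alpha>\<close> where
  \<open>\<phi>\<close> is in \<open>Jset z\<close>, and \<open>top\<close> elsewhere. Intensions
  are thus not crisp although the frame is two-valued.\<close>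

definition canon_int :: "'p fm \<Rightarrow> 'a \<times> ('p, 'a::truth_values) canonical_points \<Rightarrow> 'a" where
  "canon_int \<phi> = (\<lambda>(\<alpha>, z). crisp (\<phi> \<in> Jset z) \<rightarrow> \<alpha>)"

lemma INF_crisp:
  "(INF s\<in>S. crisp (P s) \<rightarrow> (crisp (Q s) \<rightarrow> \<alpha>)) = (crisp (\<exists>s\<in>S. P s \<and> Q s) \<rightarrow> (\<alpha> :: 'a::truth_values))"
proof (cases "\<exists>s\<in>S. P s \<and> Q s")
  case True
  then obtain s where s: "s \<in> S" "P s" "Q s" by blast
  have "(INF s\<in>S. crisp (P s) \<rightarrow> (crisp (Q s) \<rightarrow> \<alpha>)) \<le> \<alpha>"
    using s by (intro INF_lower2[of s]) (auto simp: crisp_def top_residual)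
  moreover have "\<alpha> \<le> (INF s\<in>S. crisp (P s) \<rightarrow> (crisp (Q s) \<rightarrow> \<alpha>))"
    by (intro INF_greatest) (auto simp: crisp_def top_residual)
  moreover have "(crisp (\<exists>s\<in>S. P s \<and> Q s) \<rightarrow> \<alpha>) = \<alpha>"
    using True by (simp add: crisp_def top_residual)
  ultimately show ?thesis by (metis antisym)
next
  case False
  then have "(INF s\<in>S. crisp (P s) \<rightarrow> (crisp (Q s) \<rightarrow> \<alpha>)) = (INF s\<in>S. top)"
    by (intro INF_cong) (auto simp: crisp_def top_residual)
  also have "\<dots> = (crisp (\<exists>s\<in>S. P s \<and> Q s) \<rightarrow> \<alpha>)"
    using False by (auto simp: crisp_def)
  finally show ?thesis .
qed

lemma INF_crisp_residual:
  "(INF (\<alpha>, s)\<in>UNIV \<times> S. (crisp (P s) \<rightarrow> \<alpha>) \<rightarrow> (crisp (Q s) \<rightarrow> \<alpha>))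
    = (crisp (\<not> (\<exists>s\<in>S. Q s \<and> \<not> P s)) :: 'a::truth_values)"
proof (cases "\<exists>s\<in>S. Q s \<and> \<not> P s")
  case True
  then obtain s where s: "s \<in> S" "\<not> P s" "Q s" by blast
  have "(INF (\<alpha>, s)\<in>UNIV \<times> S. (crisp (P s) \<rightarrow> \<alpha>) \<rightarrow> (crisp (Q s) \<rightarrow> \<alpha>)) \<le> (bot :: 'a)"
    \<comment> \<open>The truth value \<open>bot\<close> separates: at the pair
      \<open>(bot, s)\<close> the premise becomes \<open>top\<close> and the conclusion
      \<open>bot\<close>.\<close>
    using s by (intro INF_lower2[of "(bot, s)"]) (auto simp: crisp_def top_residual)
  with True show ?thesis by (simp add: crisp_def bot_unique)
next
  case False
  then have "top \<le> (INF (\<alpha>, s)\<in>UNIV \<times> S. (crisp (P s) \<rightarrow> \<alpha>) \<rightarrow> (crisp (Q s) \<rightarrow> (\<alpha> :: 'a)))"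
    by (intro INF_greatest) (auto simp: crisp_def top_residual)
  moreover have "crisp (\<not> (\<exists>s\<in>S. Q s \<and> \<not> P s)) = (top :: 'a)"
    using False by (auto simp: crisp_def)
  ultimately show ?thesis by (simp add: top_unique)
qed

lemma up_canon_ext:
  "x \<in> xpoints (canonical_frame i) \<Longrightarrow> up (canonical_frame i) (canon_ext \<phi>) x = canon_int \<phi> x"
  using Jset_iff[of "snd x" i \<phi>]
  by (auto simp: up_def xpoints_def canon_ext_def canon_int_def INF_crisp canonical_frame_def)

lemma dia0_canon_ext:
  "x \<in> xpoints (canonical_frame i) \<Longrightarrow> dia0 (canonical_frame i) (canon_ext \<phi>) x = canon_int (Dia \<phi>) x"
  using Dia_Jset_iff[of "snd x" i \<phi>]
  by (auto simp: dia0_def xpoints_def canon_ext_def canon_int_def INF_crisp canonical_frame_def)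

lemma down_canon_int:
  assumes "z \<in> points (canonical_frame i)"
  shows "down (canonical_frame i) (canon_int \<phi>) z = canon_ext \<phi> z"
proof -
  have rel: "edge (canonical_frame i) z z' = crisp (Fset z \<subseteq> Jset z')" for z'
    by (simp add: canonical_frame_def)
  show ?thesis
    unfolding down_def xpoints_def canon_int_def prod.case rel
    by (simp only: INF_crisp_residual Fset_iff[OF assms] not_not canon_ext_def)
qed

lemma box0_canon_int:
  assumes "z \<in> points (canonical_frame i)"
  shows "box0 (canonical_frame i) (canon_int \<phi>) z = canon_ext (Box \<phi>) z"
proof -
  have rel: "box_rel (canonical_frame i) z z' = crisp (\<forall>\<psi>. Box \<psi> \<in> Fset z \<longrightarrow> \<psi> \<in> Jset z')" for z'
    by (simp add: canonical_frame_def)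
  show ?thesis
    unfolding box0_def xpoints_def canon_int_def prod.case rel
    by (simp only: INF_crisp_residual Box_Fset_iff[OF assms] not_not canon_ext_def)
qed

lemma truth_lemma:
  fixes i :: nat
  defines "G \<equiv> canonical_frame i"
  shows "(\<forall>z\<in>points G. fst (interp G (\<lambda>p. (canon_ext (Atom p), canon_int (Atom p))) \<phi>) z = canon_ext \<phi> z) \<and>
    (\<forall>x\<in>xpoints G. snd (interp G (\<lambda>p. (canon_ext (Atom p), canon_int (Atom p))) \<phi>) x = canon_int \<phi> x)"
    (is "(\<forall>z\<in>_. fst (?I \<phi>) z = _) \<and> _")
proof -
  \<comment> \<open>Agreement with the canonical sets is known only on the carrier, but the
    operations read their arguments only there, so \<open>polar_cong\<close> applies. The three
    facts that follow work alike.\<close>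
  have upI: "\<forall>x\<in>xpoints G. up G f x = canon_int \<phi> x"
    if "\<forall>z\<in>points G. f z = canon_ext \<phi> z" for f \<phi>
  proof -
    have "up G f = up G (canon_ext \<phi>)"
      unfolding up_polar using that by (intro polar_cong) simp
    then show ?thesis by (simp add: G_def up_canon_ext)
  qed
  have downI: "\<forall>z\<in>points G. down G u z = canon_ext \<phi> z"
    if "\<forall>x\<in>xpoints G. u x = canon_int \<phi> x" for u \<phi>
  proof -
    have "down G u = down G (canon_int \<phi>)"
      unfolding down_polar using that by (intro polar_cong) simp
    then show ?thesis by (simp add: G_def down_canon_int)
  qed
  have boxI: "\<forall>z\<in>points G. box0 G u z = canon_ext (Box \<phi>) z"
    if "\<forall>x\<in>xpoints G. u x = canon_int \<phi> x" for u \<phi>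
  proof -
    have "box0 G u = box0 G (canon_int \<phi>)"
      unfolding box0_polar using that by (intro polar_cong) simp
    then show ?thesis by (simp add: G_def box0_canon_int)
  qed
  have diaI: "\<forall>x\<in>xpoints G. dia0 G f x = canon_int (Dia \<phi>) x"
    if "\<forall>z\<in>points G. f z = canon_ext \<phi> z" for f \<phi>
  proof -
    have "dia0 G f = dia0 G (canon_ext \<phi>)"
      unfolding dia0_polar using that by (intro polar_cong) simp
    then show ?thesis by (simp add: G_def dia0_canon_ext)
  qed
  show ?thesis
  proof (induction \<phi>)
    case FBot
    have "\<forall>x\<in>xpoints G. top = canon_int FBot x"
      using Jset_bot by (auto simp: canon_int_def crisp_def xpoints_def G_def)
    with downI[OF this] show ?case by (simp add: Let_def)
  next
    case FTop
    have "\<forall>z\<in>points G. top = canon_ext FTop z"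
      using Fset_top by (auto simp: canon_ext_def crisp_def G_def)
    with upI[OF this] show ?case by (simp add: Let_def)
  next
    case (And \<phi> \<psi>)
    have "And \<phi> \<psi> \<in> Fset z \<longleftrightarrow> \<phi> \<in> Fset z \<and> \<psi> \<in> Fset z" if "z \<in> points G" for z
      using that unfolding G_def by (blast intro: Fset_and Fset_mono logic.intros)
    with And have "\<forall>z\<in>points G. inf (fst (?I \<phi>) z) (fst (?I \<psi>) z) = canon_ext (And \<phi> \<psi>) z"
      by (simp add: canon_ext_def crisp_def)
    with upI[OF this] show ?case by (simp add: Let_def)
  next
    case (Or \<phi> \<psi>)
    have "Or \<phi> \<psi> \<in> Jset z \<longleftrightarrow> \<phi> \<in> Jset z \<or> \<psi> \<in> Jset z" if "z \<in> points G" for z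
      using that unfolding G_def by (blast intro: Jset_mono logic.intros dest: Jset_or)
    with Or have "\<forall>x\<in>xpoints G. inf (snd (?I \<phi>) x) (snd (?I \<psi>) x) = canon_int (Or \<phi> \<psi>) x"
      by (auto simp: canon_int_def crisp_def xpoints_def)
    with downI[OF this] show ?case by (simp add: Let_def)
  next
    case (Box \<phi>)
    then have "\<forall>z\<in>points G. box0 G (snd (?I \<phi>)) z = canon_ext (Box \<phi>) z" by (intro boxI) simp
    with upI[OF this] show ?case by (simp add: Let_def)
  next
    case (Dia \<phi>)
    then have "\<forall>x\<in>xpoints G. dia0 G (fst (?I \<phi>)) x = canon_int (Dia \<phi>) x" by (intro diaI) simp
    with downI[OF this] show ?case by (simp add: Let_def)
  qed simp
qed

section \<open>The canonical model and completeness\<close>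

lemma true_in_canonical_iff:
  fixes i :: nat and \<phi> \<psi> :: "'p fm"
  defines "G \<equiv> canonical_frame i :: (('p, 'a::truth_values) canonical_points, 'a) gframe"
  shows "true_in G (\<lambda>p. (canon_ext (Atom p), canon_int (Atom p))) (\<phi>, \<psi>) \<longleftrightarrow>
    (\<forall>z\<in>points G. \<phi> \<in> Fset z \<longrightarrow> \<psi> \<in> Fset z)"
  unfolding G_def using bot_neq_top[where 'a = 'a]
  by (auto simp: true_in_def subset_on_def truth_lemma canon_ext_def crisp_def top_unique)

lemma canonical_frame_class:
  "(canonical_frame i :: (('p, 'a::truth_values) canonical_points, 'a) gframe)
     \<in> frame_class (extra_axioms i :: 'p sequent set)"
  (is "?G \<in> _")
proof -
  have "valid ?G (Box FBot, FBot :: 'p fm)"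
    unfolding valid_def
  proof (intro allI impI)
    fix V :: "'p \<Rightarrow> _"
    let ?V = "\<lambda>p :: 'p. (canon_ext (Atom p), canon_int (Atom p))"
    have "true_in ?G ?V (Box FBot, FBot)"
      unfolding true_in_canonical_iff using Fset_mono[OF _ _ derives_box_bot] by blast
    \<comment> \<open>No atom occurs in this sequent, so its truth carries over from the canonical
      valuation to any other.\<close>
    then show "true_in ?G V (Box FBot, FBot)"
      by (simp add: true_in_def)
  qed
  moreover have "valid ?G (Box (Atom p), Atom p)" if "i \<noteq> 0" for p :: 'p
    unfolding valid_def
  proof (intro allI impI)
    fix V :: "'p \<Rightarrow> _"
    assume V: "valuation ?G V"
    \<comment> \<open>Validity concerns all valuations, not just the canonical one, so the argument
      is made on relations: a larger relation gives a smaller \<open>box0\<close>, and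
      \<open>down\<close> of the intension of an atom is its extension.\<close>
    have "edge ?G z z' \<le> box_rel ?G z z'" if "z \<in> points ?G" for z z'
      using Fset_mono[OF that _ derives_box_elim[OF \<open>i \<noteq> 0\<close>]]
      by (auto simp: canonical_frame_def crisp_def)
    then have "subset_on (points ?G) (box0 ?G u) (down ?G u)" for u
      unfolding box0_def down_def
      by (intro subset_onI INF_superset_mono) (auto intro!: residual_mono residual_antimono)
    from this[of "snd (V p)"] show "true_in ?G V (Box (Atom p), Atom p)"
      using V by (simp add: true_in_def valuation_def Let_def subset_on_def)
  qed
  ultimately show ?thesis
    by (auto simp: frame_class_def extra_axioms_def graph_frame_canonical)
qed

lemma canonical_complete:
  fixes \<phi> \<psi> :: "'p fm"
  assumes "valid (canonical_frame i :: (('p, 'a::truth_values) canonical_points, 'a) gframe) (\<phi>, \<psi>)"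
  shows "derives i \<phi> \<psi>"
proof (rule ccontr)
  let ?G = "canonical_frame i :: (('p, 'a) canonical_points, 'a) gframe"
  let ?V = "\<lambda>p :: 'p. (canon_ext (Atom p), canon_int (Atom p))"
  assume nd: "\<not> derives i \<phi> \<psi>"
  \<comment> \<open>Otherwise \<phi> \<turnstile> \<bottom> \<turnstile> \<psi>. So the filter
    generated by \<open>\<phi>\<close> belongs to a point, and it omits
    \<open>\<psi>\<close>.\<close>
  then have "\<not> derives i \<phi> FBot" by (blast intro: logic.intros)
  from principal_filter_point[OF this] obtain z :: "('p, 'a) canonical_points"
    where z: "z \<in> points ?G" "Fset z = {\<chi>. derives i \<phi> \<chi>}" by metis
  have "valuation ?G ?V" by (simp add: valuation_def up_canon_ext down_canon_int)
  then have "true_in ?G ?V (\<phi>, \<psi>)" using assms by (simp add: valid_def)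
  then show False
    using nd z by (auto simp: true_in_canonical_iff logic.ax_id)
qed

text \<open>Completeness uses the canonical frame alone, whose points fix the type in the
  equivalence. The soundness argument works over any type of points, which the second conjunct
  records.\<close>

theorem theoremB9:
  fixes i :: nat and \<phi> \<psi> :: "'p::countable fm"
  assumes "i \<in> {0, 1}"
  shows "((\<phi>, \<psi>) \<in> logic (extra_axioms i) \<longleftrightarrow>
            (\<forall>G :: (('p, 'a::truth_values) canonical_points, 'a) gframe.
               G \<in> frame_class (extra_axioms i :: 'p sequent set) \<longrightarrow> valid G (\<phi>, \<psi>)))
       \<and> ((\<phi>, \<psi>) \<in> logic (extra_axioms i) \<longrightarrow>
            (\<forall>G :: ('z, 'a) gframe. G \<in> frame_class (extra_axioms i :: 'p sequent set) \<longrightarrow> valid G (\<phi>, \<psi>)))"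
proof (intro conjI iffI impI allI)
  assume "\<forall>G :: (('p, 'a) canonical_points, 'a) gframe.
    G \<in> frame_class (extra_axioms i :: 'p sequent set) \<longrightarrow> valid G (\<phi>, \<psi>)"
  then show "(\<phi>, \<psi>) \<in> logic (extra_axioms i)"
    by (intro canonical_complete[where 'a = 'a]) (simp add: canonical_frame_class)
qed (erule (1) logic_sound)+

end
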